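(* Let $X,Y\in\mathbb{Z}^n$, $S_1=X+\Upsilon_n$ and $S_2=Y+\Upsilon_n$. Then $S_1\cap S_2=\emptyset$ if and only if $d_C(X,Y)\ge3$.
   Context: $\Upsilon_n=\{U\in\mathbb{Z}^n:\sum_i|x_i-u_i|\le1\text{ for some }X\in\{-1,0\}^n\}$ (a set of $2^n(n+1)$ points of $\mathbb{Z}^n$). The cross distance between $X=(x_1,\dots,x_n)$ and $Y=(y_1,\dots,y_n)$ in $\mathbb{Z}^n$ is $d_C(X,Y)=\sum_{i=1}^n\max\{0,|y_i-x_i|-1\}$. *)

theory Defs
  imports "HOL-Analysis.Finite_Cartesian_Product"
begin

text \<open>The lattice of integer points of dimension \<open>n\<close> is the type \<^typ>\<open>int ^ 'n\<close>
  over a finite index type with \<open>n\<close> elements; the dimension is carried by the type.\<close>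

definition Upsilon :: "(int ^ 'n) set" where
  "Upsilon = {U. \<exists>X :: int ^ 'n. (\<forall>i. X $ i \<in> {-1, 0}) \<and> (\<Sum>i\<in>UNIV. \<bar>X $ i - U $ i\<bar>) \<le> 1}"

definition cross_dist :: "int ^ 'n \<Rightarrow> int ^ 'n \<Rightarrow> int" where
  "cross_dist X Y = (\<Sum>i\<in>UNIV. max 0 (\<bar>Y $ i - X $ i\<bar> - 1))"

end

theory Submission
  imports Defs
begin

text \<open>Membership in \<open>\<Upsilon>\<^sub>n\<close> means that the distances of the coordinates to
  \<open>{-1, 0}\<close> add up to at most 1. In one coordinate, the distances of \<open>z\<close> to \<open>x + {-1, 0}\<close> and to
  \<open>y + {-1, 0}\<close> add up to at least \<open>e = max 0 (\<bar>y - x\<bar> - 1)\<close>, and by choice of \<open>z\<close> every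
  splitting of \<open>e\<close> into two natural numbers occurs. Hence the translates meet iff \<open>\<Sum> e\<^sub>i\<close>
  splits coordinatewise into two parts of total at most 1 each, that is, iff it is at most 2.\<close>

text \<open>Closed form of the distance from \<open>u\<close> to \<open>{-1, 0}\<close>: the
  arguments add up to -1, so over the integers exactly one of them is nonnegative.\<close>

definition cell_dist :: "int \<Rightarrow> int" where
  "cell_dist u = max u (- 1 - u)"

lemma cell_dist_le: "x \<in> {-1, 0} \<Longrightarrow> cell_dist u \<le> \<bar>x - u\<bar>"
  by (auto simp: cell_dist_def)

lemma cell_dist_attained: "\<exists>x\<in>{-1, 0}. \<bar>x - u\<bar> = cell_dist u"
  by (auto simp: cell_dist_def)

text \<open>The coordinates of \<open>X\<close> vary independently, so the sum is minimised by
  minimising each term.\<close>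

lemma mem_Upsilon_iff:
  fixes U :: "int ^ 'n"
  shows "U \<in> Upsilon \<longleftrightarrow> (\<Sum>i\<in>UNIV. cell_dist (U $ i)) \<le> 1"
proof
  assume "U \<in> Upsilon"
  then obtain X :: "int ^ 'n" where X: "\<And>i. X $ i \<in> {-1, 0}"
    and "(\<Sum>i\<in>UNIV. \<bar>X $ i - U $ i\<bar>) \<le> 1"
    unfolding Upsilon_def by blast
  moreover have "(\<Sum>i\<in>UNIV. cell_dist (U $ i)) \<le> (\<Sum>i\<in>UNIV. \<bar>X $ i - U $ i\<bar>)"
    by (intro sum_mono cell_dist_le X)
  ultimately show "(\<Sum>i\<in>UNIV. cell_dist (U $ i)) \<le> 1" by linarith
next
  assume le: "(\<Sum>i\<in>UNIV. cell_dist (U $ i)) \<le> 1"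
  have "\<forall>i. \<exists>x. x \<in> {-1, 0} \<and> \<bar>x - U $ i\<bar> = cell_dist (U $ i)"
    using cell_dist_attained by blast
  then obtain f where f: "\<And>i. f i \<in> {-1, 0}" "\<And>i. \<bar>f i - U $ i\<bar> = cell_dist (U $ i)"
    unfolding choice_iff by blast
  show "U \<in> Upsilon"
    unfolding Upsilon_def using f le by (intro CollectI exI[of _ "\<chi> i. f i"]) simp
qed

lemma mem_translate_iff:
  fixes X Z :: "int ^ 'n"
  shows "Z \<in> (+) X ` Upsilon \<longleftrightarrow> (\<Sum>i\<in>UNIV. cell_dist (Z $ i - X $ i)) \<le> 1"
proof -
  have "Z \<in> (+) X ` Upsilon \<longleftrightarrow> Z - X \<in> Upsilon"
    by (force simp: image_iff)
  then show ?thesis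
    by (simp add: mem_Upsilon_iff)
qed

text \<open>Triangle inequality: the left side is the gap between \<open>x + {-1, 0}\<close> and
  \<open>y + {-1, 0}\<close>.\<close>

lemma cell_dist_add_ge:
  "max 0 (\<bar>y - x\<bar> - 1) \<le> cell_dist (z - x) + cell_dist (z - y)"
  by (auto simp: cell_dist_def)

lemma cell_dist_split:
  assumes "0 \<le> k" "k \<le> max 0 (\<bar>y - x\<bar> - 1)"
  shows "\<exists>z. cell_dist (z - x) = k \<and> cell_dist (z - y) = max 0 (\<bar>y - x\<bar> - 1) - k"
proof (cases "x \<le> y")
  case True
  then show ?thesis
    \<comment> \<open>Go up \<open>k\<close> from \<open>x\<close>, the top of
      \<open>x + {-1, 0}\<close>, towards \<open>y - 1\<close>.\<close>
    using assms by (intro exI[of _ "x + k"]) (auto simp: cell_dist_def)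
next
  case False
  then show ?thesis
    \<comment> \<open>Mirror image: go down \<open>k\<close> from the bottom point
      \<open>x - 1\<close> towards \<open>y\<close>.\<close>
    using assms by (intro exI[of _ "x - 1 - k"]) (auto simp: cell_dist_def)
qed

lemma sum_le_2_split:
  fixes e :: "'a :: finite \<Rightarrow> int"
  assumes nonneg: "\<And>i. 0 \<le> e i" and le: "(\<Sum>i\<in>UNIV. e i) \<le> 2"
  obtains k where "\<And>i. 0 \<le> k i" "\<And>i. k i \<le> e i"
    "(\<Sum>i\<in>UNIV. k i) \<le> 1" "(\<Sum>i\<in>UNIV. e i - k i) \<le> 1"
proof (cases "\<forall>i. e i = 0")
  case True
  then show ?thesis
    using that[of "\<lambda>_. 0"] by simp
next
  case False
  then obtain j where "e j \<noteq> 0" by blast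
  with nonneg[of j] have "e j \<ge> 1" by linarith
  \<comment> \<open>A single unit taken at \<open>j\<close> has total 1 and leaves at most 2 - 1 =
    1.\<close>
  then show ?thesis
    using that[of "\<lambda>i. if i = j then 1 else 0"] nonneg le by (simp add: sum_subtractf)
qed

theorem theorem1:
  fixes X Y :: "int ^ 'n" and S1 S2 :: "(int ^ 'n) set"
  assumes "S1 = (+) X ` Upsilon" and "S2 = (+) Y ` Upsilon"
  shows "S1 \<inter> S2 = {} \<longleftrightarrow> cross_dist X Y \<ge> 3"
proof -
  define e where "e i = max 0 (\<bar>Y $ i - X $ i\<bar> - 1)" for i
  have dist: "cross_dist X Y = (\<Sum>i\<in>UNIV. e i)"
    by (simp add: cross_dist_def e_def)
  \<comment> \<open>Both sides of the claim are negated; for integers, failing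
    \<open>\<ge> 3\<close> means \<open>\<le> 2\<close>.\<close>
  have "(\<exists>Z. Z \<in> S1 \<and> Z \<in> S2) \<longleftrightarrow> (\<Sum>i\<in>UNIV. e i) \<le> 2"
  proof
    assume "\<exists>Z. Z \<in> S1 \<and> Z \<in> S2"
    then obtain Z where
      Z: "(\<Sum>i\<in>UNIV. cell_dist (Z $ i - X $ i)) \<le> 1" "(\<Sum>i\<in>UNIV. cell_dist (Z $ i - Y $ i)) \<le> 1"
      using assms mem_translate_iff by blast
    have "(\<Sum>i\<in>UNIV. e i) \<le> (\<Sum>i\<in>UNIV. cell_dist (Z $ i - X $ i) + cell_dist (Z $ i - Y $ i))"
      unfolding e_def by (intro sum_mono cell_dist_add_ge)
    with Z show "(\<Sum>i\<in>UNIV. e i) \<le> 2"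
      by (simp add: sum.distrib)
  next
    assume "(\<Sum>i\<in>UNIV. e i) \<le> 2"
    moreover have "0 \<le> e i" for i
      by (simp add: e_def)
    ultimately obtain k where k: "\<And>i. 0 \<le> k i" "\<And>i. k i \<le> e i"
      "(\<Sum>i\<in>UNIV. k i) \<le> 1" "(\<Sum>i\<in>UNIV. e i - k i) \<le> 1"
      using sum_le_2_split[of e] by blast
    \<comment> \<open>Each coordinate of the common point spends \<open>k i\<close> of the budget of
      \<open>X\<close> and the rest of \<open>e i\<close> from that of \<open>Y\<close>.\<close>
    have "\<exists>z. cell_dist (z - X $ i) = k i \<and> cell_dist (z - Y $ i) = e i - k i" for i
      using cell_dist_split[of "k i" "Y $ i" "X $ i"] k(1,2)[of i] by (simp add: e_def)
    then obtain f where
      f: "\<And>i. cell_dist (f i - X $ i) = k i" "\<And>i. cell_dist (f i - Y $ i) = e i - k i"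
      by metis
    have "(\<chi> i. f i) \<in> S1 \<and> (\<chi> i. f i) \<in> S2"
      using k(3,4) by (simp add: assms mem_translate_iff f)
    then show "\<exists>Z. Z \<in> S1 \<and> Z \<in> S2" by blast
  qed
  then show ?thesis
    unfolding dist by (auto simp: disjoint_iff not_le)
qed

end
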